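(* Let $r,s,v,w,x,y,z\in\mathbb{C}$ with $rv\neq0$, and let $\alpha=(\alpha_i)_{i\geq0}$, $\beta=(\beta_i)_{i\geq0}$ be complex sequences with $\alpha_0=\beta_0$. Define sequences $\rho=(\rho_i)_{i\geq0}$ and $\sigma=(\sigma_i)_{i\geq0}$ by $\rho_0=\alpha_0$, $\rho_i=\bigl(\alpha_i-\sum_{k=0}^{i-1}\binom{i}{k}r^ks^{i-k}\rho_k\bigr)/r^i$ for $i\geq1$, and $\sigma_0=\beta_0$, $\sigma_i=\bigl(\beta_i-\sum_{k=0}^{i-1}\binom{i}{k}v^kw^{i-k}\sigma_k\bigr)/v^i$ for $i\geq1$. Then \[ P_{\alpha,\beta}^{[x,y,z]}=P_{\lambda_s,\mu}^{[0,r,s]}\cdot P_{\rho,\sigma}^{\left[\frac{x-w}{v},\,\frac{y+xs+zw-sw}{rv},\,\frac{z-s}{r}\right]}\cdot\bigl(P_{\lambda_w,\mu}^{[0,v,w]}\bigr)^t, \] where each matrix is understood as its principal $n\times n$ submatrix, for any $n\geq1$.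
   Context: For complex numbers $x,y,z$ and complex sequences $\alpha=(\alpha_i)_{i\geq0}$, $\beta=(\beta_i)_{i\geq0}$ with $\alpha_0=\beta_0$, the weighted recurrence matrix $P_{\alpha,\beta}^{[x,y,z]}=[P_{i,j}]_{i,j\geq0}$ is the infinite matrix defined by $P_{i,0}=\alpha_i$, $P_{0,j}=\beta_j$ for $i,j\geq 0$, and $P_{i,j}=xP_{i,j-1}+yP_{i-1,j-1}+zP_{i-1,j}$ for $i,j\geq1$. For $z\in\mathbb{C}$, $\lambda_z=(z^i)_{i\geq0}$ (with the convention $0^0=1$), and $\mu=(1,0,0,\ldots)$; thus $P_{\lambda_s,\mu}^{[0,r,s]}$ is the lower triangular matrix with entries $\binom{i}{j}r^js^{i-j}$. $A^t$ denotes the transpose of $A$. *)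

theory Defs
  imports Complex_Main "Jordan_Normal_Form.Matrix"
begin

text \<open>Column \<open>0\<close> is \<open>\<alpha>\<close> and row \<open>0\<close> is \<open>\<beta>\<close>.  The corner entry is read off \<open>\<alpha>\<close>, so row \<open>0\<close> is
  \<open>\<beta>\<close> including the corner exactly when \<open>\<alpha> 0 = \<beta> 0\<close>, which is required of every weighted
  recurrence matrix.\<close>

fun wrec :: "complex \<Rightarrow> complex \<Rightarrow> complex \<Rightarrow> (nat \<Rightarrow> complex) \<Rightarrow> (nat \<Rightarrow> complex) \<Rightarrow> nat \<Rightarrow> nat \<Rightarrow> complex"
where
  "wrec x y z \<alpha> \<beta> i 0 = \<alpha> i"
| "wrec x y z \<alpha> \<beta> 0 (Suc j) = \<beta> (Suc j)"
| "wrec x y z \<alpha> \<beta> (Suc i) (Suc j) =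
     x * wrec x y z \<alpha> \<beta> (Suc i) j + y * wrec x y z \<alpha> \<beta> i j + z * wrec x y z \<alpha> \<beta> i (Suc j)"

lemma wrec_row_0: "\<alpha> 0 = \<beta> 0 \<Longrightarrow> wrec x y z \<alpha> \<beta> 0 j = \<beta> j"
  by (cases j) simp_all

definition geom_seq :: "complex \<Rightarrow> nat \<Rightarrow> complex" where
  "geom_seq z i = z ^ i"

definition unit_seq :: "nat \<Rightarrow> complex" where
  "unit_seq i = (if i = 0 then 1 else 0)"

lemma wrec_geom_unit:
  "wrec 0 r s (geom_seq s) unit_seq i j = of_nat (i choose j) * r ^ j * s ^ (i - j)"
proof (induction i arbitrary: j)
  case 0
  then show ?case by (cases j) (simp_all add: geom_seq_def unit_seq_def)
next
  case (Suc i)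
  show ?case
  proof (cases j)
    case 0
    then show ?thesis by (simp add: geom_seq_def)
  next
    case (Suc k)
    show ?thesis
    proof (cases "Suc k \<le> i")
      case True
      then have "s ^ (i - k) = s * s ^ (i - Suc k)"
        by (metis Suc_diff_le diff_Suc_Suc power_Suc)
      then show ?thesis using Suc Suc.IH by (simp add: algebra_simps)
    next
      case False
      then show ?thesis using Suc Suc.IH by (simp add: algebra_simps binomial_eq_0)
    qed
  qed
qed

definition principal :: "nat \<Rightarrow> (nat \<Rightarrow> nat \<Rightarrow> complex) \<Rightarrow> complex mat" where
  "principal n A = mat n n (\<lambda>(i, j). A i j)"

fun reduced_seq :: "complex \<Rightarrow> complex \<Rightarrow> (nat \<Rightarrow> complex) \<Rightarrow> nat \<Rightarrow> complex" where
  "reduced_seq r s \<alpha> i =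
     (if i = 0 then \<alpha> 0
      else (\<alpha> i - (\<Sum>k = 0..<i. of_nat (i choose k) * r ^ k * s ^ (i - k) * reduced_seq r s \<alpha> k)) / r ^ i)"

declare reduced_seq.simps [simp del]

end

theory Submission
  imports Defs
begin

text \<open>The \<open>(i, j)\<close> entry of the product is a two-fold binomial transform, in the row and in the
  column index, of the middle matrix.  Raising an index of a transform by one amounts to applying
  \<open>r E + s\<close> resp. \<open>v F + w\<close> to that matrix, where \<open>E\<close> and \<open>F\<close> are the row and column shifts.  The
  parameters of the middle matrix say that there
  \<open>r v E F = (x - w) r E + (z - s) v F + (y + x s + z w - s w)\<close>, i.e.
  \<open>(r E + s) (v F + w) = x (r E + s) + y + z (v F + w)\<close>, which is the recurrence of the left-hand
  side.  The reduced sequences are the inverse transforms of the two border sequences.\<close>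

text \<open>This is \<open>(r E + s)^i g\<close> evaluated at \<open>0\<close>, with
  \<open>E\<close> the shift; recursion on \<open>i\<close> makes raising an index a plain
  unfolding.\<close>

primrec binom_transform :: "complex \<Rightarrow> complex \<Rightarrow> nat \<Rightarrow> (nat \<Rightarrow> complex) \<Rightarrow> complex" where
  "binom_transform r s 0 g = g 0"
| "binom_transform r s (Suc i) g =
     r * binom_transform r s i (\<lambda>k. g (Suc k)) + s * binom_transform r s i g"

lemma binom_transform_add:
  "binom_transform r s i (\<lambda>k. f k + g k) = binom_transform r s i f + binom_transform r s i g"
  by (induction i arbitrary: f g) (simp_all add: algebra_simps)

lemma binom_transform_cmult:
  "binom_transform r s i (\<lambda>k. c * g k) = c * binom_transform r s i g"
  by (induction i arbitrary: g) (simp_all add: algebra_simps)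

text \<open>Row \<open>i\<close> of the weights vanishes beyond column \<open>i\<close>, so every
  cutoff above \<open>i\<close> gives the same sum.\<close>

lemma binom_transform_eq_sum:
  "i < n \<Longrightarrow>
    binom_transform r s i g = (\<Sum>k<n. wrec 0 r s (geom_seq s) unit_seq i k * g k)"
proof (induction i arbitrary: n g)
  case 0
  then obtain m where "n = Suc m" by (cases n) auto
  then show ?case
    by (simp add: sum.lessThan_Suc_shift geom_seq_def unit_seq_def del: sum.lessThan_Suc)
next
  case (Suc i)
  then obtain m where n: "n = Suc m" and "i < m" by (cases n) auto
  let ?W = "wrec 0 r s (geom_seq s) unit_seq"
  \<comment> \<open>Shifting \<open>g\<close> uses up one index, hence the bounds \<open>m\<close>
    and \<open>Suc m\<close>.\<close>
  have "(\<Sum>k<n. ?W (Suc i) k * g k) =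
      r * (\<Sum>k<m. ?W i k * g (Suc k)) + s * (\<Sum>k<Suc m. ?W i k * g k)"
    unfolding n sum.lessThan_Suc_shift
    by (simp add: geom_seq_def algebra_simps sum.distrib sum_distrib_left)
  also have "\<dots> = binom_transform r s (Suc i) g"
    using Suc.IH[of m "\<lambda>k. g (Suc k)"] Suc.IH[of "Suc m" g] \<open>i < m\<close>
    by (simp del: sum.lessThan_Suc)
  finally show ?case by simp
qed

text \<open>The recursion of \<open>reduced_seq\<close> solves this triangular system for its last
  unknown, whose coefficient \<open>r ^ i\<close> is nonzero.\<close>

lemma binom_transform_reduced_seq:
  assumes "r \<noteq> 0"
  shows "binom_transform r s i (reduced_seq r s \<alpha>) = \<alpha> i"
proof -
  have "binom_transform r s i (reduced_seq r s \<alpha>) =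
      (\<Sum>k = 0..<i. of_nat (i choose k) * r ^ k * s ^ (i - k) * reduced_seq r s \<alpha> k)
      + r ^ i * reduced_seq r s \<alpha> i"
    using binom_transform_eq_sum[of i "Suc i" r s "reduced_seq r s \<alpha>"]
    by (simp add: wrec_geom_unit atLeast0LessThan)
  also have "\<dots> = \<alpha> i"
    using assms by (cases "i = 0") (simp_all add: reduced_seq.simps[of r s \<alpha> i] reduced_seq.simps[of r s \<alpha> 0])
  finally show ?thesis .
qed

text \<open>Denominators are cleared in the parameter equations, so that the recurrence step becomes
  a polynomial identity.\<close>

lemma wrec_eq_binom_transform:
  assumes "r \<noteq> 0" "v \<noteq> 0" "\<alpha> 0 = \<beta> 0"
    and x: "x = v * a + w" and y: "y + x * s + z * w - s * w = r * v * b" and z: "z = r * c + s"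
  shows "wrec x y z \<alpha> \<beta> i j =
    binom_transform r s i (\<lambda>k. binom_transform v w j
      (wrec a b c (reduced_seq r s \<alpha>) (reduced_seq v w \<beta>) k))"
    (is "_ = binom_transform r s i (\<lambda>k. binom_transform v w j (?C k))")
proof -
  let ?Q = "\<lambda>i j. binom_transform r s i (\<lambda>k. binom_transform v w j (?C k))"
  \<comment> \<open>The two reduced sequences agree at \<open>0\<close>, so the corner fits as
    well.\<close>
  have row: "?C 0 = reduced_seq v w \<beta>"
    using assms(3) by (intro ext wrec_row_0) (simp add: reduced_seq.simps)
  have step: "?Q (Suc i) (Suc j) =
      x * ?Q (Suc i) j + y * ?Q i j + z * ?Q i (Suc j)" for i j
  proof -
    have y': "y = r * v * b - x * s - z * w + s * w"
      unfolding y[symmetric] by simp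
    show ?thesis
      by (simp add: y' x z binom_transform_add binom_transform_cmult)
        (simp add: algebra_simps)
  qed
  show "wrec x y z \<alpha> \<beta> i j = ?Q i j"
  proof (induction i arbitrary: j)
    case 0
    then show ?case
      using assms by (simp add: wrec_row_0 row binom_transform_reduced_seq)
  next
    case (Suc i)
    show ?case
    proof (induction j)
      case 0
      then show ?case
        using binom_transform_reduced_seq[OF assms(1), of s "Suc i" \<alpha>] by simp
    next
      case (Suc j)
      show ?case
        \<comment> \<open>The inner hypothesis covers the left neighbour, the outer one both entries
          of row \<open>i\<close>.\<close>
        unfolding step wrec.simps(3) Suc.IH \<open>\<And>j. wrec x y z \<alpha> \<beta> i j = ?Q i j\<close> ..
    qed
  qed
qed

theorem theorem1:
  fixes r s v w x y z :: complex
    and \<alpha> \<beta> :: "nat \<Rightarrow> complex"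
    and n :: nat
  assumes "r * v \<noteq> 0"
    and "\<alpha> 0 = \<beta> 0"
    and "n \<ge> 1"
  shows "principal n (wrec x y z \<alpha> \<beta>) =
    principal n (wrec 0 r s (geom_seq s) unit_seq)
    * principal n (wrec ((x - w) / v) ((y + x * s + z * w - s * w) / (r * v)) ((z - s) / r)
                        (reduced_seq r s \<alpha>) (reduced_seq v w \<beta>))
    * transpose_mat (principal n (wrec 0 v w (geom_seq w) unit_seq))"
proof -
  let ?R = "wrec 0 r s (geom_seq s) unit_seq" and ?V = "wrec 0 v w (geom_seq w) unit_seq"
  let ?C = "wrec ((x - w) / v) ((y + x * s + z * w - s * w) / (r * v)) ((z - s) / r)
                 (reduced_seq r s \<alpha>) (reduced_seq v w \<beta>)"
  have rv: "r \<noteq> 0" "v \<noteq> 0"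
    using assms(1) by auto
  have C: "wrec x y z \<alpha> \<beta> i j = binom_transform r s i (\<lambda>k. binom_transform v w j (?C k))" for i j
    using rv by (intro wrec_eq_binom_transform assms(2)) simp_all
  have "wrec x y z \<alpha> \<beta> i j = (\<Sum>l<n. (\<Sum>k<n. ?R i k * ?C k l) * ?V j l)"
    if "i < n" "j < n" for i j
  proof -
    \<comment> \<open>Since \<open>i\<close> and \<open>j\<close> lie below \<open>n\<close>, both
      transforms can be cut off at \<open>n\<close>.\<close>
    have "wrec x y z \<alpha> \<beta> i j = (\<Sum>k<n. ?R i k * (\<Sum>l<n. ?V j l * ?C k l))"
      using that by (simp add: C binom_transform_eq_sum[of _ n])
    also have "\<dots> = (\<Sum>k<n. \<Sum>l<n. ?R i k * ?C k l * ?V j l)"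
      by (simp add: sum_distrib_left mult_ac)
    also have "\<dots> = (\<Sum>l<n. \<Sum>k<n. ?R i k * ?C k l * ?V j l)"
      by (rule sum.swap)
    finally show ?thesis by (simp add: sum_distrib_right)
  qed
  then show ?thesis
    by (intro eq_matI)
      (simp_all add: principal_def scalar_prod_def atLeast0LessThan)
qed

end
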